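(* Let $\mathbb{X}$ and $\mathbb{Y}$ be two real vector spaces equipped with a bilinear form $\langle\cdot,\cdot\rangle:\mathbb{X}\times\mathbb{Y}\to\mathbb{R}$, let $\mathbb{W}$ be a set, let $\theta:\mathbb{W}\to\mathbb{X}$ be a mapping, and let $c_\theta:\mathbb{W}\times\mathbb{Y}\to\mathbb{R}$, $c_\theta(w,y)=\langle\theta(w),y\rangle$, be the associated one-sided linear coupling. (1) For any function $g:\mathbb{Y}\to\overline{\mathbb{R}}$, $\ g^{c_\theta'}=g^{\star'}\circ\theta$. (2) For any function $h:\mathbb{W}\to\overline{\mathbb{R}}$, $\ h^{c_\theta}=(\theta\rhd h)^{\star}$. (3) For any function $h:\mathbb{W}\to\overline{\mathbb{R}}$, $\ h^{c_\theta c_\theta'}=\big(h^{c_\theta}\big)^{\star'}\circ\theta=(\theta\rhd h)^{\star\star'}\circ\theta$. (4) For any subset $W\subset\mathbb{W}$, $\ (\delta_W)^{-c_\theta}=\sigma_{-\theta(W)}$.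
   Context: $\overline{\mathbb{R}}=[-\infty,+\infty]$; $\sup\emptyset=-\infty$, $\inf\emptyset=+\infty$. Conjugates for a real-valued coupling $b:\mathbb{W}\times\mathbb{Y}\to\mathbb{R}$: for $h:\mathbb{W}\to\overline{\mathbb{R}}$, $h^{b}(y)=\sup_{w\in\mathbb{W}}\big(b(w,y)-h(w)\big)$ for $y\in\mathbb{Y}$; for $g:\mathbb{Y}\to\overline{\mathbb{R}}$, $g^{b'}(w)=\sup_{y\in\mathbb{Y}}\big(b(w,y)-g(y)\big)$ for $w\in\mathbb{W}$; the biconjugate is $h^{bb'}=(h^{b})^{b'}$. $h^{-c_\theta}$ is the conjugate for the coupling $b=-c_\theta$. Fenchel conjugates: for $f:\mathbb{X}\to\overline{\mathbb{R}}$, $f^{\star}(y)=\sup_{x\in\mathbb{X}}(\langle x,y\rangle-f(x))$ for $y\in\mathbb{Y}$; for $g:\mathbb{Y}\to\overline{\mathbb{R}}$, $g^{\star'}(x)=\sup_{y\in\mathbb{Y}}(\langle x,y\rangle-g(y))$ for $x\in\mathbb{X}$; and $f^{\star\star'}=(f^{\star})^{\star'}$. Infimal postcomposition of $h:\mathbb{W}\to\overline{\mathbb{R}}$ by $\theta$: $(\theta\rhd h)(x)=\inf\{h(w): w\in\mathbb{W},\ \theta(w)=x\}$ for $x\in\mathbb{X}$. Characteristic function: $\delta_W(w)=0$ if $w\in W$, $+\infty$ otherwise. Support function of $X\subset\mathbb{X}$: $\sigma_X(y)=\sup_{x\in X}\langle x,y\rangle$ for $y\in\mathbb{Y}$. $-\theta(W)=\{-\theta(w):w\in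 W\}$. *)

theory Defs
  imports "HOL-Analysis.Linear_Algebra" "HOL-Library.Extended_Real"
begin

text \<open>
  The set \<open>\<W>\<close> is an arbitrary, possibly empty, carrier in the type \<open>'w\<close>. A function on
  \<open>\<W>\<close> is a function on \<open>'w\<close> of which only the values on \<open>\<W>\<close> are considered, and two such
  functions are equal when they agree on \<open>\<W>\<close>. Couplings are real-valued, so the differences
  below never have the form \<open>\<infinity> - \<infinity>\<close>. In \<^typ>\<open>ereal\<close> the supremum of the empty
  set is \<open>-\<infinity>\<close> and its infimum is \<open>\<infinity>\<close>, as required.
\<close>

definition conjugate :: "'w set \<Rightarrow> ('w \<Rightarrow> 'y \<Rightarrow> real) \<Rightarrow> ('w \<Rightarrow> ereal) \<Rightarrow> 'y \<Rightarrow> ereal" where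
  "conjugate \<W> b h y = (SUP w\<in>\<W>. ereal (b w y) - h w)"

definition reverse_conjugate :: "('w \<Rightarrow> 'y \<Rightarrow> real) \<Rightarrow> ('y \<Rightarrow> ereal) \<Rightarrow> 'w \<Rightarrow> ereal" where
  "reverse_conjugate b g w = (SUP y. ereal (b w y) - g y)"

definition biconjugate :: "'w set \<Rightarrow> ('w \<Rightarrow> 'y \<Rightarrow> real) \<Rightarrow> ('w \<Rightarrow> ereal) \<Rightarrow> 'w \<Rightarrow> ereal" where
  "biconjugate \<W> b h = reverse_conjugate b (conjugate \<W> b h)"

definition fenchel_conjugate :: "('x \<Rightarrow> 'y \<Rightarrow> real) \<Rightarrow> ('x \<Rightarrow> ereal) \<Rightarrow> 'y \<Rightarrow> ereal" where
  "fenchel_conjugate p f y = (SUP x. ereal (p x y) - f x)"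

definition reverse_fenchel_conjugate :: "('x \<Rightarrow> 'y \<Rightarrow> real) \<Rightarrow> ('y \<Rightarrow> ereal) \<Rightarrow> 'x \<Rightarrow> ereal" where
  "reverse_fenchel_conjugate p g x = (SUP y. ereal (p x y) - g y)"

definition fenchel_biconjugate :: "('x \<Rightarrow> 'y \<Rightarrow> real) \<Rightarrow> ('x \<Rightarrow> ereal) \<Rightarrow> 'x \<Rightarrow> ereal" where
  "fenchel_biconjugate p f = reverse_fenchel_conjugate p (fenchel_conjugate p f)"

definition one_sided_linear_coupling ::
    "('x \<Rightarrow> 'y \<Rightarrow> real) \<Rightarrow> ('w \<Rightarrow> 'x) \<Rightarrow> 'w \<Rightarrow> 'y \<Rightarrow> real" where
  "one_sided_linear_coupling p \<theta> w y = p (\<theta> w) y"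

definition infimal_postcomposition :: "'w set \<Rightarrow> ('w \<Rightarrow> 'x) \<Rightarrow> ('w \<Rightarrow> ereal) \<Rightarrow> 'x \<Rightarrow> ereal" where
  "infimal_postcomposition \<W> \<theta> h x = (INF w\<in>{w \<in> \<W>. \<theta> w = x}. h w)"

definition characteristic_function :: "'w set \<Rightarrow> 'w \<Rightarrow> ereal" where
  "characteristic_function W w = (if w \<in> W then 0 else \<infinity>)"

definition support_function :: "('x \<Rightarrow> 'y \<Rightarrow> real) \<Rightarrow> 'x set \<Rightarrow> 'y \<Rightarrow> ereal" where
  "support_function p X y = (SUP x\<in>X. ereal (p x y))"

end

theory Submission
  imports Defs
begin

text \<open>The coupling sees w only through \<theta> w. Hence the reverse conjugate at w is the
  reverse Fenchel conjugate at \<theta> w, and the supremum over \<open>\<W>\<close> defining the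
  conjugate can be taken fibre by fibre: on the fibre over x the coupling is constantly
  \<open>p x y\<close>, and subtracting h leaves \<open>p x y\<close> minus the infimum of h on that
  fibre, which is the infimal postcomposition. Composing both facts gives the biconjugate formula.
  For the characteristic function only points of W count, and bilinearity moves the sign of
  \<open>- c\<close> onto \<theta> w. The carrying lemmas are
  \<open>conjugate_one_sided_linear_coupling\<close> and
  \<open>conjugate_characteristic_function\<close>.\<close>

lemma ereal_minus_INF_eq_SUP: "ereal a - (INF i\<in>I. f i) = (SUP i\<in>I. ereal a - f i)"
  \<comment> \<open>Empty I is the case of a point x outside the image of \<theta>: as a is finite,
    both sides are -\<infinity>.\<close>
  by (cases "I = {}") (simp_all add: bot_ereal_def top_ereal_def SUP_ereal_minus_right)

lemma conjugate_one_sided_linear_coupling: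
  "conjugate \<W> (one_sided_linear_coupling p \<theta>) h =
    fenchel_conjugate p (infimal_postcomposition \<W> \<theta> h)"
proof
  fix y
  have "fenchel_conjugate p (infimal_postcomposition \<W> \<theta> h) y =
      (SUP x. SUP w\<in>{w \<in> \<W>. \<theta> w = x}. ereal (p x y) - h w)"
    by (simp add: fenchel_conjugate_def infimal_postcomposition_def ereal_minus_INF_eq_SUP)
  \<comment> \<open>On each fibre x may be replaced by \<theta> w, so the summand no longer depends
    on x and the double supremum merges into one over the union of the fibres.\<close>
  also have "\<dots> = (SUP x. SUP w\<in>{w \<in> \<W>. \<theta> w = x}. ereal (p (\<theta> w) y) - h w)"
    by (intro SUP_cong) auto
  also have "\<dots> = (SUP w\<in>(\<Union>x. {w \<in> \<W>. \<theta> w = x}). ereal (p (\<theta> w) y) - h w)"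
    by (simp add: SUP_UNION)
  also have "(\<Union>x. {w \<in> \<W>. \<theta> w = x}) = \<W>"
    by auto
  finally show "conjugate \<W> (one_sided_linear_coupling p \<theta>) h y =
      fenchel_conjugate p (infimal_postcomposition \<W> \<theta> h) y"
    by (simp add: conjugate_def one_sided_linear_coupling_def)
qed

lemma reverse_conjugate_one_sided_linear_coupling:
  "reverse_conjugate (one_sided_linear_coupling p \<theta>) g = reverse_fenchel_conjugate p g \<circ> \<theta>"
  by (simp add: fun_eq_iff reverse_conjugate_def reverse_fenchel_conjugate_def
      one_sided_linear_coupling_def)

text \<open>A point outside W contributes a real number minus \<infinity>, that is -\<infinity>, and
  so does not affect the supremum. The coupling is arbitrary so that \<open>- c\<close> can be
  inserted.\<close>

lemma conjugate_characteristic_function: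
  assumes "W \<subseteq> \<W>"
  shows "conjugate \<W> b (characteristic_function W) y = (SUP w\<in>W. ereal (b w y))"
  unfolding conjugate_def
proof (rule antisym)
  show "(SUP w\<in>\<W>. ereal (b w y) - characteristic_function W w) \<le> (SUP w\<in>W. ereal (b w y))"
    by (rule SUP_least) (auto simp: characteristic_function_def intro: SUP_upper)
  show "(SUP w\<in>W. ereal (b w y)) \<le> (SUP w\<in>\<W>. ereal (b w y) - characteristic_function W w)"
    using assms by (intro SUP_mono) (force simp: characteristic_function_def)
qed

theorem proposition3:
  fixes p :: "'x::real_vector \<Rightarrow> 'y::real_vector \<Rightarrow> real"
    and \<W> :: "'w set"
    and \<theta> :: "'w \<Rightarrow> 'x"
    and c :: "'w \<Rightarrow> 'y \<Rightarrow> real"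
  assumes "bilinear p"
    and "c = one_sided_linear_coupling p \<theta>"
  shows
    "(\<forall>g :: 'y \<Rightarrow> ereal. \<forall>w\<in>\<W>.
        reverse_conjugate c g w = (reverse_fenchel_conjugate p g \<circ> \<theta>) w) \<and>
     (\<forall>h :: 'w \<Rightarrow> ereal.
        conjugate \<W> c h = fenchel_conjugate p (infimal_postcomposition \<W> \<theta> h)) \<and>
     (\<forall>h :: 'w \<Rightarrow> ereal. \<forall>w\<in>\<W>.
        biconjugate \<W> c h w = (reverse_fenchel_conjugate p (conjugate \<W> c h) \<circ> \<theta>) w \<and>
        (reverse_fenchel_conjugate p (conjugate \<W> c h) \<circ> \<theta>) w =
          (fenchel_biconjugate p (infimal_postcomposition \<W> \<theta> h) \<circ> \<theta>) w) \<and>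
     (\<forall>W \<subseteq> \<W>.
        conjugate \<W> (- c) (characteristic_function W) =
          support_function p ((\<lambda>w. - \<theta> w) ` W))"
proof (intro conjI allI impI ballI)
  show "conjugate \<W> (- c) (characteristic_function W) =
      support_function p ((\<lambda>w. - \<theta> w) ` W)" if "W \<subseteq> \<W>" for W
    \<comment> \<open>\<open>bilinear_lneg\<close> identifies \<open>- p (\<theta> w) y\<close> with
      \<open>p (- \<theta> w) y\<close>; \<open>image_image\<close> helps to reindex the supremum
      over the image of W by W itself.\<close>
    using that by (simp add: fun_eq_iff conjugate_characteristic_function support_function_def
        image_image assms(2) one_sided_linear_coupling_def bilinear_lneg[OF assms(1)])
qed (simp_all add: assms(2) reverse_conjugate_one_sided_linear_coupling
    conjugate_one_sided_linear_coupling biconjugate_def fenchel_biconjugate_def)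

end
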